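(* Let $r_-\le r\le r_+$, where $r_-\approx0.3613249509$ and $r_+\approx 0.4376259168$, and let $P$ be the Cantor distribution with parameter $r$. Then, for every $n\ge2$ and every admissible index set $I$, the set $\gamma_n=\gamma_n(I)$ forms a CVT for $P$.
   Context: Let $r_-\approx 0.3613249509$ be the unique root in $(0,\frac12)$ of $13r^3-10r+3=0$ and let $r_+\approx 0.4376259168$ be the unique root in $(0,\frac12)$ of $11r^3-12r^2+10r-3=0$. For $0<r<\frac12$ let $S_1(x)=rx$ and $S_2(x)=rx+1-r$ on $\mathbb R$, and let $P$ (the Cantor distribution with parameter $r$) be the unique Borel probability measure on $\mathbb R$ with $P=\frac12 P\circ S_1^{-1}+\frac12 P\circ S_2^{-1}$. For a word $\sigma=\sigma_1\cdots\sigma_k\in\{1,2\}^k$ put $S_\sigma=S_{\sigma_1}\circ\cdots\circ S_{\sigma_k}$ and $J_\sigma=S_\sigma([0,1])$. Let $X$ be a random variable with distribution $P$; for words $\beta,\gamma,\dots,\delta$ put $a(\beta,\gamma,\dots,\delta)=E(X\mid X\in J_\beta\cup J_\gamma\cup\cdots\cup J_\delta)$; in particular $a(\sigma)=S_\sigma(\frac12)$. CVT: for a finite $\alpha\subset\mathbb R$ and $a\in\alpha$ let $M(a|\alpha)=\{x\in\mathbb R:|x-a|=\min_{b\in\alpha}|x-b|\}$ (Voronoi region). $\alpha$ is a centroidal Voronoi tessellation (CVT) with respect to a probability distribution $P$ if (i) $P(M(a|\alpha)\cap M(b|\alpha))=0$ for all $a\ne b$ in $\alpha$, and (ii) $E(X\mid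 X\in M(a|\alpha))=a$ for all $a\in\alpha$. The sets $\gamma_n(I)$: for $n\ge 2$ let $\ell(n)$ be the unique natural number with $2^{\ell(n)}\le n<2^{\ell(n)+1}$. Put $\gamma_2=\{a(1),a(2)\}$ and $\gamma_3=\{a(11,121),a(122,211),a(212,22)\}$ (no index set needed). For $n\ge4$: if $2^{\ell(n)}\le n\le 3\cdot2^{\ell(n)-1}$, for $I\subset\{1,2\}^{\ell(n)-1}$ with $\mathrm{card}(I)=n-2^{\ell(n)}$, $$\gamma_n(I)=\bigcup_{\omega\in I}S_\omega(\gamma_3)\cup\bigcup_{\omega\in\{1,2\}^{\ell(n)-1}\setminus I}S_\omega(\gamma_2);$$ if $3\cdot2^{\ell(n)-1}<n<2^{\ell(n)+1}$, for $I\subset\{1,2\}^{\ell(n)-1}$ with $\mathrm{card}(I)=n-3\cdot2^{\ell(n)-1}$, $$\gamma_n(I)=\bigcup_{\omega\in\{1,2\}^{\ell(n)-1}\setminus I}S_\omega(\gamma_3)\cup\bigcup_{\omega\in I}S_\omega(\gamma_4).$$ Here $\gamma_4=\{a(11),a(12),a(21),a(22)\}$ (the case $n=4$, $I=\emptyset$). Admissible $I$ means satisfying these conditions. *)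

theory Defs
  imports "HOL-Probability.Probability"
begin

definition r_minus :: real where
  "r_minus = (THE r. 0 < r \<and> r < 1/2 \<and> 13 * r^3 - 10 * r + 3 = 0)"

definition r_plus :: real where
  "r_plus = (THE r. 0 < r \<and> r < 1/2 \<and> 11 * r^3 - 12 * r^2 + 10 * r - 3 = 0)"

lemma r_minus_ex1: "\<exists>!r::real. 0 < r \<and> r < 1/2 \<and> 13 * r^3 - 10 * r + 3 = 0"
proof (rule ex_ex1I)
  let ?f = "\<lambda>r::real. 13 * r^3 - 10 * r + 3"
  have "\<exists>x. 0 \<le> x \<and> x \<le> 1/2 \<and> ?f x = 0"
    by (rule IVT2') (auto simp: power3_eq_cube intro!: continuous_intros)
  then obtain x where x: "0 \<le> x" "x \<le> 1/2" "?f x = 0" by blast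
  moreover have "x \<noteq> 0" using x(3) by auto
  moreover have "x \<noteq> 1/2"
  proof
    assume "x = 1/2"
    then have "?f (1/2) = 0" using x(3) by (simp only:)
    then show False by (simp add: power3_eq_cube)
  qed
  ultimately show "\<exists>r. 0 < r \<and> r < 1/2 \<and> ?f r = 0" by (intro exI[of _ x]) auto
next
  fix x y :: real
  assume x: "0 < x \<and> x < 1/2 \<and> 13 * x^3 - 10 * x + 3 = 0"
     and y: "0 < y \<and> y < 1/2 \<and> 13 * y^3 - 10 * y + 3 = 0"
  have "(x - y) * (13 * (x*x + x*y + y*y) - 10) = 0"
    using x y by (simp add: power3_eq_cube algebra_simps)
  moreover have "x*x \<le> 1/2 * (1/2)" "x*y \<le> 1/2 * (1/2)" "y*y \<le> 1/2 * (1/2)"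
    using x y by (intro mult_mono; simp)+
  ultimately show "x = y" by auto
qed

lemma r_plus_ex1: "\<exists>!r::real. 0 < r \<and> r < 1/2 \<and> 11 * r^3 - 12 * r^2 + 10 * r - 3 = 0"
proof (rule ex_ex1I)
  let ?f = "\<lambda>r::real. 11 * r^3 - 12 * r^2 + 10 * r - 3"
  have "\<exists>x. 0 \<le> x \<and> x \<le> 1/2 \<and> ?f x = 0"
    by (rule IVT') (auto simp: power3_eq_cube power2_eq_square intro!: continuous_intros)
  then obtain x where x: "0 \<le> x" "x \<le> 1/2" "?f x = 0" by blast
  moreover have "x \<noteq> 0" using x(3) by auto
  moreover have "x \<noteq> 1/2"
  proof
    assume "x = 1/2"
    then have "?f (1/2) = 0" using x(3) by (simp only:)
    then show False by (simp add: power3_eq_cube power2_eq_square)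
  qed
  ultimately show "\<exists>r. 0 < r \<and> r < 1/2 \<and> ?f r = 0" by (intro exI[of _ x]) auto
next
  fix x y :: real
  assume x: "0 < x \<and> x < 1/2 \<and> 11 * x^3 - 12 * x^2 + 10 * x - 3 = 0"
     and y: "0 < y \<and> y < 1/2 \<and> 11 * y^3 - 12 * y^2 + 10 * y - 3 = 0"
  have "(x - y) * (11 * (x*x + x*y + y*y) - 12 * (x + y) + 10) = 0"
    using x y by (simp add: power3_eq_cube power2_eq_square algebra_simps)
  moreover have "11 * (x*x + x*y + y*y) - 12 * (x + y) + 10
      = 11/4 * (x - y)\<^sup>2 + 33/4 * (x + y - 8/11)\<^sup>2 + 62/11"
    by (simp add: power2_eq_square field_simps)
  moreover have "0 < 11/4 * (x - y)\<^sup>2 + 33/4 * (x + y - 8/11)\<^sup>2 + 62/11"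
    by (intro add_nonneg_pos add_nonneg_nonneg) auto
  ultimately show "x = y" by auto
qed

text \<open>Letters are the numbers 1 and 2; \<open>S\<close> is only used for these two values.\<close>

definition S :: "real \<Rightarrow> nat \<Rightarrow> real \<Rightarrow> real" where
  "S r i x = (if i = 1 then r * x else r * x + 1 - r)"

definition words :: "nat \<Rightarrow> nat list set" where
  "words k = {\<sigma>. length \<sigma> = k \<and> set \<sigma> \<subseteq> {1, 2}}"

definition S_word :: "real \<Rightarrow> nat list \<Rightarrow> real \<Rightarrow> real" where
  "S_word r \<sigma> = foldr (\<lambda>i f. S r i \<circ> f) \<sigma> id"

definition J :: "real \<Rightarrow> nat list \<Rightarrow> real set" where
  "J r \<sigma> = S_word r \<sigma> ` {0..1}"

text \<open>For \<open>0 < r < 1/2\<close> the following conditions determine \<open>P\<close> uniquely.\<close>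

definition cantor_distribution :: "real \<Rightarrow> real measure \<Rightarrow> bool" where
  "cantor_distribution r P \<longleftrightarrow>
     prob_space P \<and> sets P = sets borel \<and>
     (\<forall>A\<in>sets borel. measure P A =
        1/2 * measure (distr P borel (S r 1)) A + 1/2 * measure (distr P borel (S r 2)) A)"

text \<open>The elementary conditional expectation of \<open>X\<close> given \<open>X \<in> B\<close> for a random
  variable \<open>X\<close> with distribution \<open>P\<close>; it is meaningful only if \<open>B\<close> has positive probability.\<close>

definition cond_mean :: "real measure \<Rightarrow> real set \<Rightarrow> real" where
  "cond_mean P B = (LINT x:B|P. x) / measure P B"

definition av :: "real \<Rightarrow> real measure \<Rightarrow> nat list list \<Rightarrow> real" where
  "av r P \<sigma>s = cond_mean P (\<Union>\<sigma>\<in>set \<sigma>s. J r \<sigma>)"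

definition voronoi :: "real set \<Rightarrow> real \<Rightarrow> real set" where
  "voronoi \<alpha> a = {x. \<bar>x - a\<bar> = Min ((\<lambda>b. \<bar>x - b\<bar>) ` \<alpha>)}"

text \<open>Positivity of the probability of each Voronoi region is demanded because otherwise
  the conditional expectation in the last condition would not be defined.\<close>

definition is_CVT :: "real measure \<Rightarrow> real set \<Rightarrow> bool" where
  "is_CVT P \<alpha> \<longleftrightarrow>
     finite \<alpha> \<and>
     (\<forall>a\<in>\<alpha>. \<forall>b\<in>\<alpha>. a \<noteq> b \<longrightarrow> measure P (voronoi \<alpha> a \<inter> voronoi \<alpha> b) = 0) \<and>
     (\<forall>a\<in>\<alpha>. measure P (voronoi \<alpha> a) > 0 \<and> cond_mean P (voronoi \<alpha> a) = a)"

definition ell :: "nat \<Rightarrow> nat" where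
  "ell n = (THE l. 2 ^ l \<le> n \<and> n < 2 ^ (l + 1))"

definition \<gamma>2 :: "real \<Rightarrow> real measure \<Rightarrow> real set" where
  "\<gamma>2 r P = {av r P [[1]], av r P [[2]]}"

definition \<gamma>3 :: "real \<Rightarrow> real measure \<Rightarrow> real set" where
  "\<gamma>3 r P = {av r P [[1,1], [1,2,1]], av r P [[1,2,2], [2,1,1]], av r P [[2,1,2], [2,2]]}"

definition \<gamma>4 :: "real \<Rightarrow> real measure \<Rightarrow> real set" where
  "\<gamma>4 r P = {av r P [[1,1]], av r P [[1,2]], av r P [[2,1]], av r P [[2,2]]}"

text \<open>For \<open>n = 2\<close> and \<open>n = 3\<close> there is no index set, so \<open>I\<close> is unconstrained by
  \<open>admissible\<close> and ignored by \<open>\<gamma>\<close>. Both are meant for \<open>n \<ge> 2\<close> only.\<close>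

definition admissible :: "nat \<Rightarrow> nat list set \<Rightarrow> bool" where
  "admissible n I \<longleftrightarrow>
     (n \<ge> 4 \<longrightarrow>
        I \<subseteq> words (ell n - 1) \<and>
        card I = (if n \<le> 3 * 2 ^ (ell n - 1) then n - 2 ^ ell n
                  else n - 3 * 2 ^ (ell n - 1)))"

definition \<gamma> :: "real \<Rightarrow> real measure \<Rightarrow> nat \<Rightarrow> nat list set \<Rightarrow> real set" where
  "\<gamma> r P n I =
     (if n = 2 then \<gamma>2 r P
      else if n = 3 then \<gamma>3 r P
      else if n \<le> 3 * 2 ^ (ell n - 1) then
        (\<Union>\<omega>\<in>I. S_word r \<omega> ` \<gamma>3 r P) \<union>
        (\<Union>\<omega>\<in>words (ell n - 1) - I. S_word r \<omega> ` \<gamma>2 r P)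
      else
        (\<Union>\<omega>\<in>words (ell n - 1) - I. S_word r \<omega> ` \<gamma>3 r P) \<union>
        (\<Union>\<omega>\<in>I. S_word r \<omega> ` \<gamma>4 r P))"

end

theory Submission
  imports Defs
begin

text \<open>
  The theorem follows from two facts: \<open>\<gamma>2\<close>, \<open>\<gamma>3\<close> and \<open>\<gamma>4\<close> are tessellations, and two
  tessellations placed in the left and the right half of the Cantor set form a tessellation
  together. Each \<open>\<gamma>\<^sub>n(I)\<close> with \<open>n \<ge> 4\<close> arises from a full binary tree of words by putting a copy
  of \<open>\<gamma>2\<close>, \<open>\<gamma>3\<close> or \<open>\<gamma>4\<close> at every leaf, so induction on the depth of the tree then gives the
  result.

  The gluing step rests on the self-similarity of \<open>P\<close>: mass and first moment of a set \<open>A\<close> are the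
  averages of those of its preimages under the two similarities. As \<open>P\<close> lives on \<open>[0,1]\<close>, a set
  that meets \<open>[0,1]\<close> only in a copy \<open>S\<^sub>i(B)\<close> has half the mass of \<open>B\<close> and conditional mean
  \<open>S\<^sub>i\<close> of the conditional mean of \<open>B\<close> (\<open>copy_in_one_piece\<close>, \<open>cond_mean_copy\<close>). Hence all that
  is needed is that, for points of \<open>[0,r]\<close>, the nearest generator belongs to the left copy, and
  symmetrically on the right (\<open>is_CVT_glue\<close>). This holds when both tessellations have a
  generator within \<open>r/2\<close> of either end of \<open>[0,1]\<close>: a point of \<open>[0,r]\<close> to the right of the last
  generator of the left copy is at distance at most \<open>r\<^sup>2/2\<close> from it, whereas the gap
  between the two halves is \<open>1 - 2r\<close>, and \<open>r\<^sup>2/2 < 1 - 2r\<close> for \<open>r \<le> r_plus\<close>.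
  Overlaps of Voronoi regions are null sets, because two regions meet in at most one point and
  \<open>P\<close> has no atoms (\<open>is_CVT_iff\<close>).

  Since \<open>\<gamma>2\<close> is glued from two copies of \<open>{1/2}\<close>, and \<open>\<gamma>4\<close> from two copies of \<open>\<gamma>2\<close>, the only
  set treated by hand is \<open>\<gamma>3 = {m, 1/2, 1 - m}\<close> with \<open>m = (2r + r\<^sup>3)/6\<close>. It is a tessellation
  as soon as the midpoint of \<open>m\<close> and \<open>1/2\<close> lies in the gap between \<open>J\<^sub>1\<^sub>2\<^sub>1\<close> and \<open>J\<^sub>1\<^sub>2\<^sub>2\<close>, that is,
  in \<open>[r - r\<^sup>2 + r\<^sup>3, r - r\<^sup>3]\<close>. The two inequalities are the ones that define the range of
  \<open>r\<close>: the left one is \<open>11r\<^sup>3 - 12r\<^sup>2 + 10r - 3 \<le> 0\<close>, the right one is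
  \<open>13r\<^sup>3 - 10r + 3 \<le> 0\<close>.
\<close>

section \<open>Voronoi regions on the line\<close>

lemma voronoi_iff:
  assumes "finite \<alpha>" "a \<in> \<alpha>"
  shows "x \<in> voronoi \<alpha> a \<longleftrightarrow> (\<forall>b\<in>\<alpha>. \<bar>x - a\<bar> \<le> \<bar>x - b\<bar>)"
  using assms by (auto simp: voronoi_def intro!: Min_eqI[symmetric])

lemma closer_to_left_iff:
  fixes a b x :: real
  assumes "a < b"
  shows "\<bar>x - a\<bar> \<le> \<bar>x - b\<bar> \<longleftrightarrow> x \<le> (a + b) / 2"
  using assms by (auto simp: abs_if)

lemma closer_to_right_iff:
  fixes a b x :: real
  assumes "a < b"
  shows "\<bar>x - b\<bar> \<le> \<bar>x - a\<bar> \<longleftrightarrow> (a + b) / 2 \<le> x"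
  using assms by (auto simp: abs_if)

lemma voronoi_borel [measurable, simp]:
  assumes "finite \<alpha>" "a \<in> \<alpha>"
  shows "voronoi \<alpha> a \<in> sets borel"
proof -
  have "voronoi \<alpha> a = (\<Inter>b\<in>\<alpha>. {x. \<bar>x - a\<bar> \<le> \<bar>x - b\<bar>})"
    using voronoi_iff[OF assms] by auto
  also have "closed \<dots>"
    by (intro closed_INT ballI closed_Collect_le continuous_intros)
  finally show ?thesis by (rule borel_closed)
qed

section \<open>Self-similarity of the Cantor distribution\<close>

locale cantor_measure =
  fixes r :: real and P :: "real measure"
  assumes r_pos: "0 < r" and r_less: "r < 1/2" and cantor: "cantor_distribution r P"
begin

(* Letters are the numerals 1 and 2; rewriting 1 to Suc 0 would hide them from the lemmas below. *)
declare One_nat_def [simp del]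

lemma prob_space_P: "prob_space P"
  using cantor by (simp add: cantor_distribution_def)

sublocale prob_space P by (rule prob_space_P)

lemma sets_P [measurable_cong, simp]: "sets P = sets borel"
  using cantor by (simp add: cantor_distribution_def)

lemma space_P [simp]: "space P = UNIV"
  using sets_eq_imp_space_eq[OF sets_P] by simp

lemma S_affine: "S r i x = r * x + S r i 0"
  by (simp add: S_def)

lemma S_measurable [measurable]: "S r i \<in> borel_measurable borel"
  unfolding S_def[abs_def] by measurable

lemma S_vimage_borel [measurable, simp]: "A \<in> sets borel \<Longrightarrow> S r i -` A \<in> sets borel"
  using measurable_sets[OF S_measurable, of A i] by simp

lemma S_mem_unit: "x \<in> {0..1} \<Longrightarrow> S r i x \<in> {0..1}"
proof -
  assume x: "x \<in> {0..1}"
  then have "0 \<le> r * x" "r * x \<le> r" using r_pos by (auto intro: mult_left_le)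
  moreover from this have "r * x \<le> 1" "r * x + 1 - r \<le> 1" "0 \<le> r * x + 1 - r"
    using r_less by linarith+
  ultimately show ?thesis by (simp add: S_def)
qed

lemma S_pieces_disjoint:
  assumes "x \<in> {0..1}" "y \<in> {0..1}"
  shows "S r 1 x < S r 2 y"
proof -
  have "r * x \<le> r * 1" "0 \<le> r * y" using assms r_pos by (auto intro: mult_left_mono)
  then show ?thesis using r_less by (simp add: S_def)
qed

lemma S_eq_iff [simp]: "S r i x = S r i y \<longleftrightarrow> x = y"
  using r_pos by (simp add: S_def)

lemma measure_split:
  assumes [measurable]: "A \<in> sets borel"
  shows "measure P A = (measure P (S r 1 -` A) + measure P (S r 2 -` A)) / 2"
proof -
  have "measure (distr P borel (S r i)) A = measure P (S r i -` A)" for i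
    by (subst measure_distr) auto
  then show ?thesis
    using cantor assms by (simp add: cantor_distribution_def add_divide_distrib del: sets_P)
qed

text \<open>The factor on the left avoids division of extended nonnegative numbers.\<close>

lemma nn_integral_split:
  assumes "f \<in> borel_measurable borel"
  shows "2 * (\<integral>\<^sup>+x. f x \<partial>P) = (\<integral>\<^sup>+x. f (S r 1 x) \<partial>P) + (\<integral>\<^sup>+x. f (S r 2 x) \<partial>P)"
  using assms
proof (induction rule: borel_measurable_induct)
  case (cong f g)
  then show ?case by simp
next
  case (set A)
  then have [measurable]: "A \<in> sets borel" by simp
  have *: "(\<integral>\<^sup>+x. indicator A (S r i x) \<partial>P) = emeasure P (S r i -` A)" for i
  proof -
    have "(\<integral>\<^sup>+x. indicator A (S r i x) \<partial>P) = (\<integral>\<^sup>+x. indicator (S r i -` A) x \<partial>P)"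
      by (intro nn_integral_cong) (auto simp: indicator_def)
    then show ?thesis by simp
  qed
  have "2 * emeasure P A = ennreal (2 * measure P A)"
    by (simp add: emeasure_eq_measure ennreal_mult')
  also have "2 * measure P A = measure P (S r 1 -` A) + measure P (S r 2 -` A)"
    by (simp add: measure_split[of A])
  also have "ennreal \<dots> = emeasure P (S r 1 -` A) + emeasure P (S r 2 -` A)"
    by (simp add: emeasure_eq_measure)
  finally show ?case
    unfolding * by simp
next
  case (mult u c)
  note [measurable] = mult(2)
  have "2 * (\<integral>\<^sup>+x. c * u x \<partial>P) = c * (2 * (\<integral>\<^sup>+x. u x \<partial>P))"
    by (subst nn_integral_cmult) (auto simp: mult_ac)
  also have "\<dots> = c * (\<integral>\<^sup>+x. u (S r 1 x) \<partial>P) + c * (\<integral>\<^sup>+x. u (S r 2 x) \<partial>P)"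
    by (simp add: mult.IH distrib_left)
  finally show ?case by (simp add: nn_integral_cmult)
next
  case (add u v)
  note [measurable] = add.hyps(1,3)
  show ?case
    using add.IH by (simp add: nn_integral_add distrib_left add_ac)
next
  case (seq U)
  note [measurable] = seq(1)
  have inc: "incseq (\<lambda>k x. U k (S r i x))" for i
    using seq(3) by (auto simp: incseq_def le_fun_def)
  have 1: "(\<integral>\<^sup>+x. (SUP k. U k) x \<partial>P) = (SUP k. \<integral>\<^sup>+x. U k x \<partial>P)"
    unfolding SUP_apply by (rule nn_integral_monotone_convergence_SUP) (auto intro: seq)
  have 2: "(\<integral>\<^sup>+x. (SUP k. U k) (S r i x) \<partial>P) = (SUP k. \<integral>\<^sup>+x. U k (S r i x) \<partial>P)" for i
    unfolding SUP_apply by (rule nn_integral_monotone_convergence_SUP) (auto intro: inc)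
  have inc': "incseq (\<lambda>k. \<integral>\<^sup>+x. U k (S r i x) \<partial>P)" for i
    using inc by (auto simp: incseq_def le_fun_def intro!: nn_integral_mono)
  show ?case
    unfolding 1 2 by (simp add: SUP_mult_left_ennreal seq.IH ennreal_SUP_add inc')
qed

lemma integral_split:
  fixes f :: "real \<Rightarrow> real"
  assumes [measurable]: "f \<in> borel_measurable borel" and f: "\<And>x. 0 \<le> f x" "\<And>x. f x \<le> 1"
  shows "(LINT x|P. f x) = ((LINT x|P. f (S r 1 x)) + (LINT x|P. f (S r 2 x))) / 2"
proof -
  have conv: "(\<integral>\<^sup>+x. ennreal (g x) \<partial>P) = ennreal (LINT x|P. g x)"
    if [measurable]: "g \<in> borel_measurable borel" and "\<And>x. 0 \<le> g x" "\<And>x. g x \<le> 1" for g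
    by (rule nn_integral_eq_integral)
       (use that in \<open>auto intro!: integrable_const_bound[where B = 1]\<close>)
  have "ennreal (2 * (LINT x|P. f x))
      = ennreal ((LINT x|P. f (S r 1 x)) + (LINT x|P. f (S r 2 x)))"
    using nn_integral_split[of "\<lambda>x. ennreal (f x)"] f
    by (simp add: conv ennreal_mult' integral_nonneg)
  moreover have "0 \<le> (LINT x|P. f x)" "0 \<le> (LINT x|P. f (S r 1 x)) + (LINT x|P. f (S r 2 x))"
    using f by (auto intro!: add_nonneg_nonneg integral_nonneg)
  ultimately show ?thesis by (subst (asm) ennreal_inj) auto
qed

text \<open>The similarities contract towards \<open>[0,1]\<close>, so that their preimages move the outside of
  \<open>[0,1]\<close> away by the factor \<open>1/r\<close>. The mass at distance more than \<open>t\<close> from \<open>[0,1]\<close> is thus at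
  most the mass at distance more than \<open>t/r\<^sup>n\<close>, for every \<open>n\<close>.\<close>

lemma prob_unit: "prob {0..1} = 1"
proof -
  \<comment> \<open>The points at distance more than \<open>t\<close> from \<open>[0,1]\<close>.\<close>
  define D where "D t = {x::real. \<bar>x - 1/2\<bar> > 1/2 + t}" for t
  have [measurable]: "D t \<in> sets borel" for t unfolding D_def by measurable
  have step: "prob (D t) \<le> prob (D (t / r))" if "t \<ge> 0" for t
  proof -
    have "S r i -` D t \<subseteq> D (t / r)" for i
    proof
      fix x assume "x \<in> S r i -` D t"
      then consider "S r i x > 1 + t" | "S r i x < - t" by (auto simp: D_def abs_if split: if_splits)
      then have "x > 1 + t / r \<or> x < - (t / r)"
        using r_pos r_less that
      proof cases
        case 1
        then have "r * x > r + t" using r_pos r_less by (auto simp: S_def split: if_splits)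
        then show ?thesis using r_pos by (auto simp: field_simps)
      next
        case 2
        then have "r * x < - t" using r_pos r_less by (auto simp: S_def split: if_splits)
        then show ?thesis using r_pos by (auto simp: field_simps)
      qed
      then show "x \<in> D (t / r)" by (auto simp: D_def)
    qed
    then have "prob (S r i -` D t) \<le> prob (D (t / r))" for i
      by (intro finite_measure_mono) auto
    from this[of 1] this[of 2] show ?thesis by (subst measure_split) auto
  qed
  have null: "prob (D t) = 0" if "t > 0" for t
  proof -
    have le: "prob (D t) \<le> prob (D (t / r ^ n))" for n
    proof (induction n)
      case (Suc n)
      show ?case using order_trans[OF Suc step[of "t / r ^ n"]] that r_pos by (simp add: mult_ac)
    qed simp
    have anti: "D u \<subseteq> D s" if "s \<le> u" for s u using that by (auto simp: D_def)
    have "(\<lambda>n. prob (D (real n))) \<longlonglongrightarrow> prob (\<Inter>n. D (real n))"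
      by (rule finite_Lim_measure_decseq) (auto simp: decseq_def intro: anti[THEN subsetD, rotated])
    moreover have "(\<Inter>n. D (real n)) = {}"
    proof -
      have "\<exists>n. x \<notin> D (real n)" for x
      proof -
        obtain n where "\<bar>x - 1/2\<bar> < real n" using reals_Archimedean2 by blast
        then have "x \<notin> D (real n)" by (simp add: D_def)
        then show ?thesis ..
      qed
      then show ?thesis by auto
    qed
    ultimately have lim: "(\<lambda>n. prob (D (real n))) \<longlonglongrightarrow> 0" by simp
    have "prob (D t) \<le> prob (D (real m))" for m
    proof -
      obtain n where n: "real m / t < (1 / r) ^ n"
        using real_arch_pow[of "1 / r"] r_pos r_less by auto
      have "D (t / r ^ n) \<subseteq> D (real m)"
        using n that r_pos by (intro anti) (auto simp: field_simps)
      then have "prob (D (t / r ^ n)) \<le> prob (D (real m))"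
        by (intro finite_measure_mono) auto
      then show ?thesis using le[of n] by linarith
    qed
    then have "prob (D t) \<le> 0" using LIMSEQ_le_const[OF lim] by blast
    then show ?thesis by (simp add: measure_le_0_iff)
  qed
  have "AE x in P. \<forall>n. x \<notin> D (1 / real (Suc n))"
    unfolding AE_all_countable
  proof
    fix n
    show "AE x in P. x \<notin> D (1 / real (Suc n))"
      using null[of "1 / real (Suc n)"]
      by (intro AE_not_in) (auto simp: null_sets_def emeasure_eq_measure)
  qed
  then have "AE x in P. x \<in> {0..1}"
  proof eventually_elim
    case (elim x)
    show "x \<in> {0..1}"
    proof (rule ccontr)
      assume "x \<notin> {0..1}"
      then have "\<bar>x - 1/2\<bar> - 1/2 > 0" by (auto simp: abs_if)
      then obtain n where "1 / real (Suc n) < \<bar>x - 1/2\<bar> - 1/2"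
        unfolding inverse_eq_divide[symmetric] using reals_Archimedean by blast
      then show False using elim[rule_format, of n] by (simp add: D_def)
    qed
  qed
  then show ?thesis by (subst prob_eq_1) auto
qed

lemma AE_unit: "AE x in P. x \<in> {0..1}"
  using prob_unit by (intro AE_prob_1) auto

lemma measure_cong_AE:
  assumes "AE x in P. x \<in> A \<longleftrightarrow> x \<in> B" "A \<in> sets borel" "B \<in> sets borel"
  shows "measure P A = measure P B"
  using assms by (intro finite_measure_eq_AE) auto

lemma integral_cong_AE_set:
  assumes "AE x in P. x \<in> A \<longleftrightarrow> x \<in> B" and [measurable]: "A \<in> sets borel" "B \<in> sets borel"
  shows "(LINT x:A|P. x) = (LINT x:B|P. x)"
  unfolding set_lebesgue_integral_def
proof (rule integral_cong_AE)
  show "AE x in P. indicat_real A x *\<^sub>R x = indicat_real B x *\<^sub>R x"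
    using assms(1) by eventually_elim (simp add: indicator_def)
qed measurable

lemma cond_mean_cong_AE:
  assumes "AE x in P. x \<in> A \<longleftrightarrow> x \<in> B" "A \<in> sets borel" "B \<in> sets borel"
  shows "cond_mean P A = cond_mean P B"
  using measure_cong_AE[OF assms] integral_cong_AE_set[OF assms] by (simp add: cond_mean_def)

lemma set_integrable_id:
  assumes [measurable]: "A \<in> sets borel"
  shows "set_integrable P A (\<lambda>x. x)"
  unfolding set_integrable_def
proof (rule integrable_const_bound[where B = 1])
  show "AE x in P. norm (indicat_real A x *\<^sub>R x) \<le> 1"
    using AE_unit by eventually_elim (auto simp: indicator_def)
qed measurable

text \<open>First moments are averaged like masses, but the similarity itself enters: \<open>S\<^sub>i\<close> has slope \<open>r\<close>
  and intercept \<open>S\<^sub>i(0)\<close>.\<close>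

lemma set_integral_split:
  assumes [measurable]: "A \<in> sets borel"
  shows "2 * (LINT x:A|P. x)
    = (\<Sum>i\<in>{1, 2}. r * (LINT x:S r i -` A|P. x) + S r i 0 * measure P (S r i -` A))"
proof -
  \<comment> \<open>Cutting off outside \<open>[0,1]\<close> changes the integrand only on a null set and makes it bounded.\<close>
  define f where "f x = indicat_real (A \<inter> {0..1}) x * x" for x
  have [measurable]: "f \<in> borel_measurable borel" unfolding f_def by measurable
  have "(LINT x:A|P. x) = (LINT x|P. f x)"
    unfolding set_lebesgue_integral_def
  proof (rule integral_cong_AE)
    show "AE x in P. indicat_real A x *\<^sub>R x = f x"
      using AE_unit by eventually_elim (simp add: indicator_def f_def)
  qed measurable
  also have "2 * \<dots> = (LINT x|P. f (S r 1 x)) + (LINT x|P. f (S r 2 x))"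
    by (subst integral_split) (auto simp: f_def indicator_def)
  finally have sum: "2 * (LINT x:A|P. x) = (LINT x|P. f (S r 1 x)) + (LINT x|P. f (S r 2 x))" .
  have piece: "(LINT x|P. f (S r i x))
      = r * (LINT x:S r i -` A|P. x) + S r i 0 * measure P (S r i -` A)" for i
  proof -
    let ?B = "S r i -` A"
    have "(LINT x|P. f (S r i x))
        = (LINT x|P. r * (indicat_real ?B x *\<^sub>R x) + S r i 0 * indicat_real ?B x)"
    proof (rule integral_cong_AE)
      show "AE x in P. f (S r i x) = r * (indicat_real ?B x *\<^sub>R x) + S r i 0 * indicat_real ?B x"
        using AE_unit
      proof eventually_elim
        case (elim x)
        then show ?case
          using S_mem_unit[of x i] S_affine[of i x] by (simp add: f_def indicator_def)
      qed
    qed measurable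
    also have "\<dots> = r * (LINT x:?B|P. x) + S r i 0 * measure P ?B"
      using set_integrable_id[of ?B]
      by (subst Bochner_Integration.integral_add)
         (auto simp: set_integrable_def set_lebesgue_integral_def integrable_indicator_iff
           less_top[symmetric])
    finally show ?thesis .
  qed
  show ?thesis unfolding sum by (simp add: piece)
qed

text \<open>The link between a tessellation and its copies: up to null sets, \<open>A\<close> is \<open>S\<^sub>i(B)\<close>, so one of the two
  terms in the self-similarity relation is that of \<open>B\<close> and the other one vanishes.\<close>

lemma copy_in_one_piece:
  assumes [measurable]: "A \<in> sets borel" "B \<in> sets borel"
    and i: "i \<in> {1, 2}" and j: "j \<in> {1, 2}" "j \<noteq> i"
    and copy: "S r i -` A \<inter> {0..1} = B \<inter> {0..1}" and other: "S r j -` A \<inter> {0..1} = {}"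
  shows "measure P A = measure P B / 2"
    and "(LINT x:A|P. x) = (r * (LINT x:B|P. x) + S r i 0 * measure P B) / 2"
proof -
  have "AE x in P. x \<in> S r i -` A \<longleftrightarrow> x \<in> B" "AE x in P. x \<in> S r j -` A \<longleftrightarrow> x \<in> {}"
    using AE_unit by (eventually_elim, use copy other in blast)+
  then have eqs: "measure P (S r i -` A) = measure P B" "measure P (S r j -` A) = 0"
    "(LINT x:S r i -` A|P. x) = (LINT x:B|P. x)" "(LINT x:S r j -` A|P. x) = 0"
    using measure_cong_AE[of "S r i -` A" B] measure_cong_AE[of "S r j -` A" "{}"]
      integral_cong_AE_set[of "S r i -` A" B] integral_cong_AE_set[of "S r j -` A" "{}"]
    by (auto simp: set_lebesgue_integral_def)
  have ij: "{1, 2} = {i, j}" using i j by auto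
  have "2 * measure P A = (\<Sum>i\<in>{1, 2}. measure P (S r i -` A))"
    by (simp add: measure_split[of A])
  then show "measure P A = measure P B / 2"
    unfolding ij using j(2) eqs by simp
  have "2 * (LINT x:A|P. x)
    = (\<Sum>i\<in>{1, 2}. r * (LINT x:S r i -` A|P. x) + S r i 0 * measure P (S r i -` A))"
    by (rule set_integral_split) simp
  then show "(LINT x:A|P. x) = (r * (LINT x:B|P. x) + S r i 0 * measure P B) / 2"
    unfolding ij using j(2) eqs by simp
qed

lemma cond_mean_copy:
  assumes "measure P B > 0" "measure P A = measure P B / 2"
    and "(LINT x:A|P. x) = (r * (LINT x:B|P. x) + S r i 0 * measure P B) / 2"
  shows "cond_mean P A = S r i (cond_mean P B)"
proof -
  have "cond_mean P A = r * cond_mean P B + S r i 0"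
    using assms(1) unfolding cond_mean_def assms(2,3) by (simp add: field_simps)
  then show ?thesis using S_affine[of i "cond_mean P B"] by simp
qed

text \<open>Only one of the two preimages of a point can lie in \<open>[0,1]\<close>, so a point has at most half the
  mass of some other point; iterating this leaves no mass.\<close>

lemma no_atoms: "measure P {x} = 0"
proof -
  have "measure P {x} \<le> (1/2) ^ n" for n x
  proof (induction n arbitrary: x)
    case (Suc n)
    have *: "\<exists>z. S r i -` {x} = {z}" for i
    proof
      show "S r i -` {x} = {(x - S r i 0) / r}"
        using r_pos by (auto simp: S_affine[of i "_ / _"] S_def field_simps)
    qed
    obtain y z where yz: "S r 1 -` {x} = {y}" "S r 2 -` {x} = {z}"
      using *[of 1] *[of 2] by blast
    have "y \<notin> {0..1} \<or> z \<notin> {0..1}"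
    proof -
      have "S r 1 y = x" "S r 2 z = x" using yz by blast+
      then show ?thesis using S_pieces_disjoint[of y z] by auto
    qed
    moreover have "measure P {w} = 0" if "w \<notin> {0..1}" for w
    proof -
      have "AE x in P. x \<in> {w} \<longleftrightarrow> x \<in> {}"
        using AE_unit by eventually_elim (use that in auto)
      then show ?thesis using measure_cong_AE[of "{w}" "{}"] by simp
    qed
    ultimately show ?case
      using Suc.IH[of y] Suc.IH[of z] measure_split[of "{x}"] yz by auto
  qed simp
  moreover have "(\<lambda>n. (1/2::real) ^ n) \<longlonglongrightarrow> 0" by (rule LIMSEQ_realpow_zero) auto
  ultimately have "measure P {x} \<le> 0"
    using LIMSEQ_le_const by blast
  then show ?thesis by (simp add: measure_le_0_iff)
qed

lemma AE_neq: "AE x in P. x \<noteq> c"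
proof -
  have "{c} \<in> null_sets P" by (simp add: null_sets_def emeasure_eq_measure no_atoms)
  then show ?thesis using AE_not_in[of "{c}"] by simp
qed

lemma integral_id: "(LINT x:UNIV|P. x) = 1/2"
proof -
  let ?m = "LINT x:UNIV|P. x"
  have "2 * ?m = 2 * r * ?m + (1 - r)"
    using set_integral_split[of UNIV] prob_space by (simp add: S_def)
  then have "(1 - r) * (2 * ?m - 1) = 0" by (simp add: algebra_simps)
  then show ?thesis using r_less by simp
qed

section \<open>Mass and mean of the basic intervals\<close>

lemma S_word_Nil [simp]: "S_word r [] = id"
  by (simp add: S_word_def)

lemma S_word_Cons [simp]: "S_word r (i # \<sigma>) = S r i \<circ> S_word r \<sigma>"
  by (simp add: S_word_def)

lemma J_Nil: "J r [] = {0..1}"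
  by (simp add: J_def)

lemma J_Cons: "J r (i # \<sigma>) = S r i ` J r \<sigma>"
  by (simp add: J_def image_comp)

lemma S_image_Icc: "S r i ` {a..b} = {S r i a..S r i b}"
proof -
  have "S r i = (\<lambda>x. r * x + S r i 0)" using S_affine[of i] by blast
  then show ?thesis
    using r_pos
    by (metis image_affinity_atLeastAtMost atLeastatMost_empty_iff2 image_is_empty less_imp_le
        mult_le_cancel_left_pos add_le_cancel_right)
qed

lemma J_eq_Icc: "J r \<sigma> = {S_word r \<sigma> 0..S_word r \<sigma> 1}"
  by (induction \<sigma>) (simp_all add: J_Nil J_Cons S_image_Icc)

lemma J_borel [measurable, simp]: "J r \<sigma> \<in> sets borel"
  by (simp add: J_eq_Icc)

lemma J_subset_unit: "J r \<sigma> \<subseteq> {0..1}"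
proof (induction \<sigma>)
  case (Cons i \<sigma>)
  then show ?case using S_mem_unit by (auto simp: J_Cons simp del: atLeastAtMost_iff)
qed (simp add: J_Nil)

lemma words_0: "words 0 = {[]}"
  by (auto simp: words_def)

lemma words_Suc: "words (Suc k) = (\<Union>i\<in>{1, 2}. (#) i ` words k)"
  by (auto simp: words_def length_Suc_conv)

lemma mass_J:
  assumes "\<sigma> \<in> words k"
  shows "measure P (J r \<sigma>) = 1 / 2 ^ k \<and> (LINT x:J r \<sigma>|P. x) = S_word r \<sigma> (1/2) / 2 ^ k"
  using assms
proof (induction k arbitrary: \<sigma>)
  case 0
  have "AE x in P. x \<in> {0..1} \<longleftrightarrow> x \<in> UNIV" using AE_unit by simp
  then show ?case
    using 0 integral_id prob_unit integral_cong_AE_set[of "{0..1}" UNIV] by (simp add: words_0 J_Nil)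
next
  case (Suc k)
  then obtain i \<tau> where \<sigma>: "\<sigma> = i # \<tau>" "i \<in> {1, 2}" "\<tau> \<in> words k"
    by (auto simp: words_Suc)
  define j where "j = (if i = 1 then 2 else 1 :: nat)"
  have j: "j \<in> {1, 2}" "j \<noteq> i" using \<sigma>(2) by (auto simp: j_def)
  have "S r i -` J r \<sigma> \<inter> {0..1} = J r \<tau> \<inter> {0..1}"
    unfolding \<sigma>(1) J_Cons by auto
  moreover have "S r j -` J r \<sigma> \<inter> {0..1} = {}"
  proof -
    have "S r j x \<noteq> S r i y" if "x \<in> {0..1}" "y \<in> {0..1}" for x y
      using S_pieces_disjoint[OF that] S_pieces_disjoint[OF that(2,1)] \<sigma>(2) j by auto
    then show ?thesis using J_subset_unit[of \<tau>] unfolding \<sigma>(1) J_Cons by blast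
  qed
  ultimately show ?case
    using copy_in_one_piece[of "J r \<sigma>" "J r \<tau>" i j] Suc.IH[OF \<sigma>(3)] \<sigma>(2) j
      S_affine[of i "S_word r \<tau> (1/2)"]
    by (simp add: \<sigma>(1) field_simps)
qed

lemma av_single:
  assumes "\<sigma> \<in> words k"
  shows "av r P [\<sigma>] = S_word r \<sigma> (1/2)"
  using mass_J[OF assms] by (simp add: av_def cond_mean_def)

lemma mass_and_av_pair:
  assumes "\<sigma> \<in> words k" "\<tau> \<in> words l" and disj: "J r \<sigma> \<inter> J r \<tau> = {}"
  shows "measure P (J r \<sigma> \<union> J r \<tau>) = 1 / 2 ^ k + 1 / 2 ^ l"
    and "av r P [\<sigma>, \<tau>]
      = (S_word r \<sigma> (1/2) / 2 ^ k + S_word r \<tau> (1/2) / 2 ^ l) / (1 / 2 ^ k + 1 / 2 ^ l)"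
proof -
  note m = mass_J[OF assms(1)] mass_J[OF assms(2)]
  show 1: "measure P (J r \<sigma> \<union> J r \<tau>) = 1 / 2 ^ k + 1 / 2 ^ l"
    using m disj by (subst finite_measure_Union) auto
  have 2: "(LINT x:J r \<sigma> \<union> J r \<tau>|P. x) = S_word r \<sigma> (1/2) / 2 ^ k + S_word r \<tau> (1/2) / 2 ^ l"
    using m disj by (subst set_integral_Un) (auto intro: set_integrable_id)
  show "av r P [\<sigma>, \<tau>]
      = (S_word r \<sigma> (1/2) / 2 ^ k + S_word r \<tau> (1/2) / 2 ^ l) / (1 / 2 ^ k + 1 / 2 ^ l)"
    using 1 2 by (simp add: av_def cond_mean_def)
qed

lemma finite_words: "finite (words k)"
  by (induction k) (simp_all add: words_0 words_Suc)

text \<open>The preimages of the union over level \<open>k + 1\<close> contain the union over level \<open>k\<close>, so full mass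
  passes from each level to the next.\<close>

lemma AE_J_level: "AE x in P. x \<in> (\<Union>\<sigma>\<in>words k. J r \<sigma>)"
proof -
  have [measurable, simp]: "(\<Union>\<sigma>\<in>words k. J r \<sigma>) \<in> sets borel" for k
    by (intro sets.finite_UN finite_words) auto
  have "prob (\<Union>\<sigma>\<in>words k. J r \<sigma>) = 1"
  proof (induction k)
    case 0
    show ?case by (simp add: words_0 J_Nil prob_unit)
  next
    case (Suc k)
    have "prob (\<Union>\<sigma>\<in>words k. J r \<sigma>) \<le> prob (S r i -` (\<Union>\<sigma>\<in>words (Suc k). J r \<sigma>))"
      if "i \<in> {1, 2}" for i
    proof (rule finite_measure_mono)
      show "(\<Union>\<sigma>\<in>words k. J r \<sigma>) \<subseteq> S r i -` (\<Union>\<sigma>\<in>words (Suc k). J r \<sigma>)"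
        using that by (auto simp: words_Suc J_Cons)
    qed simp
    from this[of 1] this[of 2]
    have "prob (\<Union>\<sigma>\<in>words (Suc k). J r \<sigma>) \<ge> 1"
      using Suc by (subst measure_split) auto
    then show ?case using prob_le_1 antisym by blast
  qed
  then show ?thesis by (intro AE_prob_1) auto
qed

section \<open>Gluing two tessellations\<close>

text \<open>A common point of the regions of \<open>a \<noteq> b\<close> can only be the midpoint of \<open>a\<close> and \<open>b\<close>, so overlaps
  are null sets for want of atoms, and a tessellation is recognised by its conditional means.\<close>

lemma is_CVT_iff:
  assumes "finite \<alpha>"
  shows "is_CVT P \<alpha> \<longleftrightarrow>
    (\<forall>a\<in>\<alpha>. measure P (voronoi \<alpha> a) > 0 \<and> cond_mean P (voronoi \<alpha> a) = a)"
proof -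
  have "measure P (voronoi \<alpha> a \<inter> voronoi \<alpha> b) = 0" if "a \<in> \<alpha>" "b \<in> \<alpha>" "a \<noteq> b" for a b
  proof -
    have "voronoi \<alpha> a \<inter> voronoi \<alpha> b \<subseteq> {(a + b) / 2}"
    proof
      fix x assume "x \<in> voronoi \<alpha> a \<inter> voronoi \<alpha> b"
      then have "\<bar>x - a\<bar> = \<bar>x - b\<bar>" by (simp add: voronoi_def)
      then show "x \<in> {(a + b) / 2}" using that(3) by (auto simp: abs_eq_iff)
    qed
    then have "measure P (voronoi \<alpha> a \<inter> voronoi \<alpha> b) \<le> measure P {(a + b) / 2}"
      by (intro finite_measure_mono) auto
    then show ?thesis by (simp add: no_atoms measure_le_0_iff)
  qed
  then show ?thesis using assms by (auto simp: is_CVT_def)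
qed

text \<open>The separation hypothesis says that every point in the \<open>i\<close>-th half of \<open>[0,1]\<close> is closer to some
  generator of the \<open>i\<close>-th copy than to all generators of the other one. Hence inside
  that half the Voronoi regions are the copies of the old ones, and the regions of the other copy
  do not reach into it.\<close>

lemma is_CVT_glue:
  fixes \<alpha> :: "nat \<Rightarrow> real set"
  defines "U \<equiv> \<Union>i\<in>{1, 2}. S r i ` \<alpha> i"
  assumes cvt: "\<And>i. i \<in> {1, 2} \<Longrightarrow> is_CVT P (\<alpha> i)"
    and sep: "\<And>i j x. i \<in> {1, 2} \<Longrightarrow> j \<in> {1, 2} \<Longrightarrow> i \<noteq> j \<Longrightarrow> x \<in> {0..1} \<Longrightarrow>
      \<exists>a\<in>\<alpha> i. \<forall>b\<in>\<alpha> j. \<bar>S r i x - S r i a\<bar> < \<bar>S r i x - S r j b\<bar>"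
  shows "is_CVT P U"
proof -
  have fin: "finite (\<alpha> i)" if "i \<in> {1, 2}" for i using cvt[OF that] by (simp add: is_CVT_def)
  then have finU: "finite U" by (auto simp: U_def)
  have "measure P (voronoi U c) > 0 \<and> cond_mean P (voronoi U c) = c" if cU: "c \<in> U" for c
  proof -
    obtain i where i: "i \<in> {1, 2}" and "c \<in> S r i ` \<alpha> i"
      using cU unfolding U_def by (rule UN_E)
    then obtain a where a: "a \<in> \<alpha> i" and c: "c = S r i a" by (elim imageE)
    define j where "j = (if i = 1 then 2 else 1 :: nat)"
    have j: "j \<in> {1, 2}" "j \<noteq> i" "{1, 2} = {i, j}" using i by (auto simp: j_def)
    have scale: "\<bar>S r i x - S r i y\<bar> \<le> \<bar>S r i x - S r i z\<bar> \<longleftrightarrow> \<bar>x - y\<bar> \<le> \<bar>x - z\<bar>" for x y z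
    proof -
      have "\<bar>S r i x - S r i y\<bar> = r * \<bar>x - y\<bar>" for x y
        using r_pos by (simp add: S_def right_diff_distrib[symmetric] abs_mult)
      then show ?thesis using r_pos by simp
    qed
    have U: "U = S r i ` \<alpha> i \<union> S r j ` \<alpha> j" unfolding U_def j(3) by auto
    have V: "y \<in> voronoi U c \<longleftrightarrow> (\<forall>b\<in>\<alpha> i. \<bar>y - S r i a\<bar> \<le> \<bar>y - S r i b\<bar>)
        \<and> (\<forall>b\<in>\<alpha> j. \<bar>y - S r i a\<bar> \<le> \<bar>y - S r j b\<bar>)" for y
      using voronoi_iff[OF finU cU] by (auto simp: U c)
    have "S r i -` voronoi U c \<inter> {0..1} = voronoi (\<alpha> i) a \<inter> {0..1}"
    proof -
      have "S r i x \<in> voronoi U c \<longleftrightarrow> x \<in> voronoi (\<alpha> i) a" if x: "x \<in> {0..1}" for x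
      proof -
        obtain a' where "a' \<in> \<alpha> i" "\<And>b. b \<in> \<alpha> j \<Longrightarrow> \<bar>S r i x - S r i a'\<bar> < \<bar>S r i x - S r j b\<bar>"
          using sep[OF i j(1) j(2)[symmetric] x] by blast
        then have "\<bar>S r i x - S r i a\<bar> \<le> \<bar>S r i x - S r j b\<bar>"
          if "\<forall>b\<in>\<alpha> i. \<bar>S r i x - S r i a\<bar> \<le> \<bar>S r i x - S r i b\<bar>" "b \<in> \<alpha> j" for b
          using that by (meson less_imp_le order_trans)
        then show ?thesis unfolding V voronoi_iff[OF fin[OF i] a] scale by blast
      qed
      then show ?thesis by auto
    qed
    moreover have "S r j -` voronoi U c \<inter> {0..1} = {}"
    proof -
      have "S r j x \<notin> voronoi U c" if "x \<in> {0..1}" for x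
        using sep[OF j(1) i j(2) that] a unfolding V by (meson not_le)
      then show ?thesis by auto
    qed
    ultimately have copy: "measure P (voronoi U c) = measure P (voronoi (\<alpha> i) a) / 2"
      "(LINT x:voronoi U c|P. x)
        = (r * (LINT x:voronoi (\<alpha> i) a|P. x) + S r i 0 * measure P (voronoi (\<alpha> i) a)) / 2"
      using copy_in_one_piece[of "voronoi U c" "voronoi (\<alpha> i) a" i j] finU cU fin[OF i] a i j
      by auto
    have "measure P (voronoi (\<alpha> i) a) > 0" "cond_mean P (voronoi (\<alpha> i) a) = a"
      using cvt[OF i] a by (auto simp: is_CVT_def)
    then show ?thesis using copy cond_mean_copy[OF _ copy] c by simp
  qed
  then show ?thesis using is_CVT_iff[OF finU] by blast
qed

text \<open>The seed of the construction: \<open>\<gamma>2\<close> is glued from two copies of it.\<close>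

lemma is_CVT_singleton: "is_CVT P {1/2}"
proof -
  have "voronoi {1/2} (1/2) = UNIV" by (auto simp: voronoi_def)
  then show ?thesis
    using integral_id prob_space by (simp add: is_CVT_iff cond_mean_def)
qed

end

section \<open>The range of the contraction ratio\<close>

text \<open>The two sign conditions are what \<open>r_minus \<le> r \<le> r_plus\<close> means.\<close>

locale cantor_tessellation = cantor_measure +
  assumes cubic_minus: "13 * r^3 - 10 * r + 3 \<le> 0"
    and cubic_plus: "11 * r^3 - 12 * r^2 + 10 * r - 3 \<le> 0"
begin

text \<open>Equivalent to \<open>r\<^sup>2/2 < 1 - 2r\<close>: the error \<open>r\<^sup>2/2\<close> with which the generators of a half reach
  its inner end is smaller than the gap between the halves. The bound holds up to
  \<open>-2 + \<surd>6 \<approx> 0.449\<close>, and \<open>0.44\<close> lies between \<open>r_plus\<close> and that number.\<close>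

lemma r_bound: "r * r + 4 * r < 2"
proof -
  have "r < 44/100"
  proof (rule ccontr)
    assume "\<not> r < 44/100"
    then obtain d where d: "r = 44/100 + d" "0 \<le> d"
      by (metis add.commute diff_add_cancel diff_ge_0_iff_ge not_less)
    \<comment> \<open>The Taylor expansion of the cubic at \<open>0.44\<close> has only positive coefficients.\<close>
    have "11 * r^3 - 12 * r^2 + 10 * r - 3
      = 11 * d^3 + 252/100 * d^2 + (58288/10000) * d + 13824/1000000"
      unfolding d by (simp add: power3_eq_cube power2_eq_square field_simps)
    moreover have "0 \<le> d^3" "0 \<le> d^2" using d by auto
    ultimately show False using cubic_plus d by linarith
  qed
  moreover have "r * r \<le> 44/100 * (44/100)"
    using r_pos calculation by (intro mult_mono) auto
  ultimately show ?thesis by linarith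
qed

text \<open>The property that survives gluing. Generators near both ends of \<open>[0,1]\<close> secure the separation
  of the next gluing step, on whichever side the tessellation is placed.\<close>

definition gluable :: "real set \<Rightarrow> bool" where
  "gluable \<alpha> \<longleftrightarrow> is_CVT P \<alpha> \<and> \<alpha> \<subseteq> {0..1} \<and> (\<exists>a\<in>\<alpha>. a \<le> r / 2) \<and> (\<exists>a\<in>\<alpha>. 1 - r / 2 \<le> a)"

text \<open>The witness for separation is the generator near the inner end of the half that contains the
  point. If the point lies beyond it, towards the gap, the distance is at most \<open>r\<^sup>2/2\<close>, less than
  the width of the gap; otherwise the generator lies between the point and the gap.\<close>

lemma gluable_glue:
  fixes \<alpha> :: "nat \<Rightarrow> real set"
  assumes gluable: "\<And>i. i \<in> {1, 2} \<Longrightarrow> gluable (\<alpha> i)"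
  shows "gluable (\<Union>i\<in>{1, 2}. S r i ` \<alpha> i)"
proof -
  have unit: "0 \<le> a" "a \<le> 1" if "a \<in> \<alpha> i" "i \<in> {1, 2}" for a i
    using gluable[OF that(2)] that(1) by (auto simp: gluable_def)
  have le: "0 \<le> r * b" "r * b \<le> r" if "0 \<le> b" "b \<le> 1" for b
    using that r_pos by (auto intro: mult_left_le)
  obtain a1 where a1: "a1 \<in> \<alpha> 1" "1 - r / 2 \<le> a1" using gluable[of 1] by (auto simp: gluable_def)
  obtain a2 where a2: "a2 \<in> \<alpha> 2" "a2 \<le> r / 2" using gluable[of 2] by (auto simp: gluable_def)
  have S_simps: "S r 1 x = r * x" "S r 2 x = r * x + 1 - r" for x by (simp_all add: S_def)
  have near1: "\<bar>S r 1 x - S r 1 a1\<bar> < \<bar>S r 1 x - S r 2 b\<bar>" if "x \<in> {0..1}" "b \<in> \<alpha> 2" for x b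
  proof -
    have "r * (1 - r / 2) \<le> r * a1" using a1(2) r_pos by (intro mult_left_mono) auto
    then have "- (r * r / 2) + r \<le> r * a1" by (simp add: algebra_simps)
    moreover have "0 \<le> r * x" "r * x \<le> r" "0 \<le> r * b" "r * b \<le> r" "r * a1 \<le> r" "0 \<le> r * a1"
      using le unit[OF a1(1)] unit[OF that(2)] that(1) by auto
    ultimately show ?thesis
      using r_bound r_less unfolding S_simps by linarith
  qed
  have near2: "\<bar>S r 2 x - S r 2 a2\<bar> < \<bar>S r 2 x - S r 1 b\<bar>" if "x \<in> {0..1}" "b \<in> \<alpha> 1" for x b
  proof -
    have "r * a2 \<le> r * (r / 2)" using a2(2) r_pos by (intro mult_left_mono) auto
    then have "r * a2 \<le> r * r / 2" by (simp add: algebra_simps)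
    moreover have "0 \<le> r * x" "r * x \<le> r" "0 \<le> r * b" "r * b \<le> r" "r * a2 \<le> r" "0 \<le> r * a2"
      using le unit[OF a2(1)] unit[OF that(2)] that(1) by auto
    ultimately show ?thesis
      using r_bound r_less unfolding S_simps by linarith
  qed
  have "is_CVT P (\<Union>i\<in>{1, 2}. S r i ` \<alpha> i)"
  proof (rule is_CVT_glue)
    fix i j x assume ij: "i \<in> {1, 2::nat}" "j \<in> {1, 2::nat}" "i \<noteq> j" and x: "x \<in> {0..1::real}"
    from ij consider "i = 1" "j = 2" | "i = 2" "j = 1" by auto
    then show "\<exists>a\<in>\<alpha> i. \<forall>b\<in>\<alpha> j. \<bar>S r i x - S r i a\<bar> < \<bar>S r i x - S r j b\<bar>"
    proof cases
      case 1
      then show ?thesis using near1[OF x] a1(1) by (intro bexI[of _ a1]) simp_all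
    next
      case 2
      then show ?thesis using near2[OF x] a2(1) by (intro bexI[of _ a2]) simp_all
    qed
  qed (use gluable in \<open>auto simp: gluable_def\<close>)
  moreover have "(\<Union>i\<in>{1, 2}. S r i ` \<alpha> i) \<subseteq> {0..1}"
    using S_mem_unit gluable by (fastforce simp: gluable_def subset_eq)
  moreover have "\<exists>a\<in>(\<Union>i\<in>{1, 2}. S r i ` \<alpha> i). a \<le> r / 2"
  proof -
    obtain a where a: "a \<in> \<alpha> 1" "a \<le> r / 2" using gluable[of 1] by (auto simp: gluable_def)
    have "r * a \<le> r * (1 / 2)" using a(2) r_pos r_less by (intro mult_left_mono) auto
    then show ?thesis using a(1) by (intro bexI[of _ "S r 1 a"]) (auto simp: S_def)
  qed
  moreover have "\<exists>a\<in>(\<Union>i\<in>{1, 2}. S r i ` \<alpha> i). 1 - r / 2 \<le> a"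
  proof -
    obtain a where a: "a \<in> \<alpha> 2" "1 - r / 2 \<le> a" using gluable[of 2] by (auto simp: gluable_def)
    have "r * (1 / 2) \<le> r * a" using a(2) r_pos r_less by (intro mult_left_mono) auto
    then show ?thesis using a(1) by (intro bexI[of _ "S r 2 a"]) (auto simp: S_def)
  qed
  ultimately show ?thesis by (simp add: gluable_def)
qed

text \<open>The first letter of a word selects the half, so the union over words of length \<open>k + 1\<close> is glued
  from two unions over words of length \<open>k\<close>.\<close>

lemma gluable_subdivision:
  assumes "\<And>\<omega>. \<omega> \<in> words k \<Longrightarrow> gluable (f \<omega>)"
  shows "gluable (\<Union>\<omega>\<in>words k. S_word r \<omega> ` f \<omega>)"
  using assms
proof (induction k arbitrary: f)
  case 0
  then show ?case by (simp add: words_0)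
next
  case (Suc k)
  have "(\<Union>\<omega>\<in>words (Suc k). S_word r \<omega> ` f \<omega>)
    = (\<Union>i\<in>{1, 2}. S r i ` (\<Union>\<omega>\<in>words k. S_word r \<omega> ` f (i # \<omega>)))"
    by (simp add: words_Suc image_UN image_comp UN_Un)
  moreover have "gluable (\<Union>\<omega>\<in>words k. S_word r \<omega> ` f (i # \<omega>))" if "i \<in> {1, 2}" for i
    using that Suc.prems by (intro Suc.IH) (auto simp: words_Suc)
  ultimately show ?case by (simp only: gluable_glue)
qed

section \<open>The three building blocks\<close>

text \<open>The gluing lemma for \<open>gluable\<close> does not apply here, as \<open>1/2\<close> is far from both ends of
  \<open>[0,1]\<close>; separation holds because \<open>1/2\<close>, the midpoint of the two generators, lies in the gap
  between the halves.\<close>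

lemma gluable_\<gamma>2: "gluable (\<gamma>2 r P)"
proof -
  have eq: "\<gamma>2 r P = (\<Union>i\<in>{1, 2}. S r i ` {1/2})"
    using av_single[of "[1]" 1] av_single[of "[2]" 1]
    by (auto simp: \<gamma>2_def words_def)
  have "is_CVT P (\<Union>i\<in>{1, 2}. S r i ` {1/2})"
  proof (rule is_CVT_glue)
    fix i j x assume ij: "i \<in> {1, 2::nat}" "j \<in> {1, 2::nat}" "i \<noteq> j" and x: "x \<in> {0..1::real}"
    have "0 \<le> r * x" "r * x \<le> r" using x r_pos by (auto intro: mult_left_le)
    then show "\<exists>a\<in>{1/2}. \<forall>b\<in>{1/2}. \<bar>S r i x - S r i a\<bar> < \<bar>S r i x - S r j b\<bar>"
      using ij r_less by (auto simp: S_def)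
  qed (rule is_CVT_singleton)
  moreover have "\<gamma>2 r P = {r / 2, 1 - r / 2}" by (auto simp: eq S_def)
  ultimately show ?thesis
    unfolding gluable_def eq[symmetric] using r_pos r_less by auto
qed

lemma gluable_\<gamma>4: "gluable (\<gamma>4 r P)"
proof -
  have "\<gamma>4 r P = (\<Union>i\<in>{1, 2}. S r i ` \<gamma>2 r P)"
    using av_single[of "[_]" 1] av_single[of "[_, _]" 2]
    by (auto simp: \<gamma>2_def \<gamma>4_def words_def)
  then show ?thesis using gluable_glue[of "\<lambda>_. \<gamma>2 r P"] gluable_\<gamma>2 by simp
qed

text \<open>\<open>P\<close> is carried by the eight intervals of level three, and \<open>\<gamma>3\<close> groups them into three blocks
  of neighbours. If the Voronoi boundaries \<open>t\<close> and \<open>1 - t\<close> separate the blocks, the Voronoi regions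
  agree with the blocks almost everywhere, and the generators are by definition the conditional
  means of the blocks.\<close>

lemma gluable_\<gamma>3: "gluable (\<gamma>3 r P)"
proof -
  define q c where "q = r * r" and "c = r * r * r"
  have "q < r / 2" "c < q / 2" "0 < c"
    using r_pos r_less by (auto simp: q_def c_def)
  note bounds = this r_pos r_less
  have lo: "13 * c - 10 * r + 3 \<le> 0" and hi: "11 * c - 12 * q + 10 * r - 3 \<le> 0"
    using cubic_minus cubic_plus by (simp_all add: q_def c_def power3_eq_cube power2_eq_square)
  define X where "X \<sigma> \<tau> = J r \<sigma> \<union> J r \<tau>" for \<sigma> \<tau>
  have J11: "J r [1,1] = {0..q}" and J22: "J r [2,2] = {1 - q..1}"
    and J121: "J r [1,2,1] = {r - q..r - q + c}" and J122: "J r [1,2,2] = {r - c..r}"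
    and J211: "J r [2,1,1] = {1 - r..1 - r + c}" and J212: "J r [2,1,2] = {1 - r + q - c..1 - r + q}"
    by (simp_all add: J_eq_Icc S_def q_def c_def algebra_simps)
  note Js = J11 J22 J121 J122 J211 J212
  have J3: "J r [1,1,1] = {0..c}" "J r [1,1,2] = {q - c..q}"
    "J r [2,2,1] = {1 - q..1 - q + c}" "J r [2,2,2] = {1 - c..1}"
    by (simp_all add: J_eq_Icc S_def q_def c_def algebra_simps)
  define m where "m = (2 * r + c) / 6"
  have w: "[1,1] \<in> words 2" "[2,2] \<in> words 2" "[1,2,1] \<in> words 3" "[1,2,2] \<in> words 3"
    "[2,1,1] \<in> words 3" "[2,1,2] \<in> words 3"
    by (auto simp: words_def)
  have disj: "J r [1,1] \<inter> J r [1,2,1] = {}" "J r [1,2,2] \<inter> J r [2,1,1] = {}"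
    "J r [2,1,2] \<inter> J r [2,2] = {}"
    unfolding Js using bounds by auto
  note pair = mass_and_av_pair[OF w(1,3) disj(1)] mass_and_av_pair[OF w(4,5) disj(2)]
    mass_and_av_pair[OF w(6,2) disj(3)]
  have av: "av r P [[1,1],[1,2,1]] = m" "av r P [[1,2,2],[2,1,1]] = 1/2"
    "av r P [[2,1,2],[2,2]] = 1 - m"
    unfolding pair by (simp_all add: S_def m_def c_def field_simps)
  have eq: "\<gamma>3 r P = {m, 1/2, 1 - m}" by (simp add: \<gamma>3_def av)
  have fin: "finite (\<gamma>3 r P)" by (simp add: eq)
  have m: "0 \<le> m" "m < 1/2" "m \<le> r / 2" using bounds by (auto simp: m_def)
  have level: "AE x in P. x \<in> X [1,1] [1,2,1] \<or> x \<in> X [1,2,2] [2,1,1] \<or> x \<in> X [2,1,2] [2,2]"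
    using AE_J_level[of 3]
  proof eventually_elim
    case (elim x)
    have "words 3 = {[1,1,1],[1,1,2],[1,2,1],[1,2,2],[2,1,1],[2,1,2],[2,2,1],[2,2,2]}"
      by (auto simp: numeral_3_eq_3 words_Suc words_0)
    with elim have "x \<in> J r [1,1,1] \<or> x \<in> J r [1,1,2] \<or> x \<in> J r [1,2,1] \<or> x \<in> J r [1,2,2]
        \<or> x \<in> J r [2,1,1] \<or> x \<in> J r [2,1,2] \<or> x \<in> J r [2,2,1] \<or> x \<in> J r [2,2,2]"
      by simp
    moreover have "J r [1,1,1] \<subseteq> J r [1,1]" "J r [1,1,2] \<subseteq> J r [1,1]"
      "J r [2,2,1] \<subseteq> J r [2,2]" "J r [2,2,2] \<subseteq> J r [2,2]"
      unfolding Js J3 using bounds by auto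
    ultimately show ?case unfolding X_def by blast
  qed
  define t where "t = (m + 1/2) / 2"
  have "t < 1/2" using m by (simp add: t_def)
  have "12 * t = 2 * r + c + 3" by (simp add: t_def m_def)
  \<comment> \<open>The boundary \<open>t\<close> lies in the gap between \<open>J\<^sub>1\<^sub>2\<^sub>1\<close> and \<open>J\<^sub>1\<^sub>2\<^sub>2\<close>, end points included;
    this is what the two cubic inequalities say.\<close>
  then have t: "r - q + c \<le> t" "t \<le> r - c" using lo hi by linarith+
  have "AE x in P. (x \<in> voronoi (\<gamma>3 r P) m \<longleftrightarrow> x \<in> X [1,1] [1,2,1]) \<and>
      (x \<in> voronoi (\<gamma>3 r P) (1/2) \<longleftrightarrow> x \<in> X [1,2,2] [2,1,1]) \<and>
      (x \<in> voronoi (\<gamma>3 r P) (1 - m) \<longleftrightarrow> x \<in> X [2,1,2] [2,2])"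
    \<comment> \<open>For \<open>r = r_minus\<close> and \<open>r = r_plus\<close> the boundary \<open>t\<close> is an end point of \<open>J\<^sub>1\<^sub>2\<^sub>2\<close> or \<open>J\<^sub>1\<^sub>2\<^sub>1\<close>
      and belongs to two Voronoi regions; the null sets \<open>{t}\<close> and \<open>{1 - t}\<close> are left out.\<close>
    using level AE_neq[of t] AE_neq[of "1 - t"]
  proof eventually_elim
    case (elim x)
    have ball: "(\<forall>b\<in>\<gamma>3 r P. Q b) \<longleftrightarrow> Q m \<and> Q (1/2) \<and> Q (1 - m)" for Q
      by (simp add: eq)
    have lt: "m < 1/2" "m < 1 - m" "1/2 < 1 - m" using m by auto
    note closer = lt[THEN closer_to_left_iff] lt[THEN closer_to_right_iff]
    have mem: "m \<in> \<gamma>3 r P" "1/2 \<in> \<gamma>3 r P" "1 - m \<in> \<gamma>3 r P" by (simp_all add: eq)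
    have "2 * t = m + 1/2" by (simp add: t_def)
    then have V: "x \<in> voronoi (\<gamma>3 r P) m \<longleftrightarrow> x < t"
      "x \<in> voronoi (\<gamma>3 r P) (1/2) \<longleftrightarrow> t < x \<and> x < 1 - t"
      "x \<in> voronoi (\<gamma>3 r P) (1 - m) \<longleftrightarrow> 1 - t < x"
      unfolding mem[THEN voronoi_iff[OF fin]] ball closer using elim(2,3) \<open>t < 1/2\<close> by auto
    have "x \<in> X [1,1] [1,2,1] \<Longrightarrow> x \<le> t" "x \<in> X [1,2,2] [2,1,1] \<Longrightarrow> t \<le> x \<and> x \<le> 1 - t"
      "x \<in> X [2,1,2] [2,2] \<Longrightarrow> 1 - t \<le> x"
      using t bounds by (auto simp: X_def Js)
    then show ?case using elim V \<open>t < 1/2\<close> by linarith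
  qed
  then have cells: "AE x in P. x \<in> voronoi (\<gamma>3 r P) m \<longleftrightarrow> x \<in> X [1,1] [1,2,1]"
      "AE x in P. x \<in> voronoi (\<gamma>3 r P) (1/2) \<longleftrightarrow> x \<in> X [1,2,2] [2,1,1]"
      "AE x in P. x \<in> voronoi (\<gamma>3 r P) (1 - m) \<longleftrightarrow> x \<in> X [2,1,2] [2,2]"
    by simp_all
  have cell: "measure P (voronoi (\<gamma>3 r P) a) > 0 \<and> cond_mean P (voronoi (\<gamma>3 r P) a) = a"
    if "AE x in P. x \<in> voronoi (\<gamma>3 r P) a \<longleftrightarrow> x \<in> X \<sigma> \<tau>" "a \<in> \<gamma>3 r P"
      "measure P (J r \<sigma> \<union> J r \<tau>) > 0" "av r P [\<sigma>, \<tau>] = a"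
    for a \<sigma> \<tau>
  proof -
    have B: "voronoi (\<gamma>3 r P) a \<in> sets borel" "X \<sigma> \<tau> \<in> sets borel"
      using that(2) fin by (simp_all add: X_def)
    show ?thesis
      using measure_cong_AE[OF that(1) B] cond_mean_cong_AE[OF that(1) B] that(3,4)
      by (simp add: X_def av_def)
  qed
  have "is_CVT P (\<gamma>3 r P)"
    unfolding is_CVT_iff[OF fin]
  proof
    fix a assume "a \<in> \<gamma>3 r P"
    then consider "a = m" | "a = 1/2" | "a = 1 - m" unfolding eq by blast
    then show "measure P (voronoi (\<gamma>3 r P) a) > 0 \<and> cond_mean P (voronoi (\<gamma>3 r P) a) = a"
      using cell[OF cells(1) _ _ av(1)] cell[OF cells(2) _ _ av(2)] cell[OF cells(3) _ _ av(3)]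
      by cases (hypsubst, simp add: eq pair(1,3,5))+
  qed
  then show ?thesis using m by (auto simp: gluable_def eq)
qed

end

section \<open>The tessellations \<open>\<gamma>\<^sub>n(I)\<close>\<close>

text \<open>Each cubic is its linear factor at the root times a quadratic cofactor of constant sign: negative
  on \<open>(0, 1/2)\<close> for the first cubic, positive for the second one by completing squares.\<close>

lemma cubic_bounds:
  assumes "r_minus \<le> r" "r \<le> r_plus"
  shows "0 < r" "r < 1/2" "13 * r^3 - 10 * r + 3 \<le> 0" "11 * r^3 - 12 * r^2 + 10 * r - 3 \<le> 0"
proof -
  define u v where "u = r_minus" and "v = r_plus"
  have u: "0 < u" "u < 1/2" "13 * u^3 - 10 * u + 3 = 0"
    using theI'[OF r_minus_ex1] by (auto simp: u_def r_minus_def)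
  have v: "0 < v" "v < 1/2" "11 * v^3 - 12 * v^2 + 10 * v - 3 = 0"
    using theI'[OF r_plus_ex1] by (auto simp: v_def r_plus_def)
  show r: "0 < r" "r < 1/2" using assms u v by (auto simp: u_def v_def)
  have "13 * r^3 - 10 * r + 3 = (r - u) * (13 * (r*r + r*u + u*u) - 10)"
    using u(3) by (simp add: power3_eq_cube algebra_simps)
  moreover have "r*r \<le> 1/2 * (1/2)" "r*u \<le> 1/2 * (1/2)" "u*u \<le> 1/2 * (1/2)"
    using r u by (intro mult_mono; simp)+
  ultimately show "13 * r^3 - 10 * r + 3 \<le> 0"
    using assms(1) by (auto simp: u_def intro: mult_nonneg_nonpos)
  have "11 * r^3 - 12 * r^2 + 10 * r - 3 = (r - v) * (11 * (r * r + r * v + v * v) - 12 * (r + v) + 10)"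
    using v(3) by (simp add: power3_eq_cube power2_eq_square algebra_simps)
  moreover have "11 * (r * r + r * v + v * v) - 12 * (r + v) + 10
      = 11/4 * (r - v)\<^sup>2 + 33/4 * (r + v - 8/11)\<^sup>2 + 62/11"
    by (simp add: power2_eq_square field_simps)
  moreover have "0 \<le> 11/4 * (r - v)\<^sup>2 + 33/4 * (r + v - 8/11)\<^sup>2 + 62/11"
    by (intro add_nonneg_nonneg) auto
  ultimately show "11 * r^3 - 12 * r^2 + 10 * r - 3 \<le> 0"
    using assms(2) by (auto simp: v_def intro: mult_nonpos_nonneg)
qed

theorem proposition2p8:
  fixes r :: real and P :: "real measure" and n :: nat and I :: "nat list set"
  assumes "r_minus \<le> r" and "r \<le> r_plus"
    and "cantor_distribution r P"
    and "n \<ge> 2" and "admissible n I"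
  shows "is_CVT P (\<gamma> r P n I)"
proof -
  interpret cantor_tessellation r P
    using cubic_bounds[OF assms(1,2)] assms(3) by unfold_locales
  \<comment> \<open>Both cases of the definition distribute two building blocks over the words of one length.\<close>
  have mix: "gluable ((\<Union>\<omega>\<in>A. S_word r \<omega> ` \<alpha>) \<union> (\<Union>\<omega>\<in>words k - A. S_word r \<omega> ` \<beta>))"
    if "A \<subseteq> words k" "gluable \<alpha>" "gluable \<beta>" for k A \<alpha> \<beta>
  proof -
    have "(\<Union>\<omega>\<in>A. S_word r \<omega> ` \<alpha>) \<union> (\<Union>\<omega>\<in>words k - A. S_word r \<omega> ` \<beta>)
      = (\<Union>\<omega>\<in>A \<union> (words k - A). S_word r \<omega> ` (if \<omega> \<in> A then \<alpha> else \<beta>))"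
      unfolding UN_Un by (intro arg_cong2[of _ _ _ _ "(\<union>)"] SUP_cong) simp_all
    also have "A \<union> (words k - A) = words k" using that(1) by auto
    finally show ?thesis using gluable_subdivision[of k "\<lambda>\<omega>. if \<omega> \<in> A then \<alpha> else \<beta>"] that by auto
  qed
  consider "n = 2" | "n = 3" | "n \<ge> 4" using assms(4) by linarith
  then have "gluable (\<gamma> r P n I)"
  proof cases
    case 3
    then have "I \<subseteq> words (ell n - 1)" using assms(5) by (simp add: admissible_def)
    from mix[OF this gluable_\<gamma>3 gluable_\<gamma>2] mix[OF this gluable_\<gamma>4 gluable_\<gamma>3] 3
    show ?thesis by (simp add: \<gamma>_def Un_commute)
  qed (simp_all add: \<gamma>_def gluable_\<gamma>2 gluable_\<gamma>3)
  then show ?thesis by (simp add: gluable_def)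
qed

end
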